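(* Let $X$ be a smooth, compact $d$-dimensional Riemannian manifold without boundary, $d\ge3$, and let $f:\mathbb{N}\to\mathbb{N}$ satisfy $f(N)\ge f(N-1)+2$ for all $N\ge1$. Then, for $N_0$ big enough, the rival shops have a winning strategy for all $N\ge N_0$; that is, for every sequence $(x_i)_{i\ge1}$ in $X$ they can choose a sequence $(y_j)_{j\ge1}$ in $X$ such that, with $$\mu_N=\sum_{i=1}^N\delta_{x_i}-\sum_{j=1}^{f(N)}\delta_{y_j},$$ for all $N\ge N_0$, $$\mathbf{W}_1^{1,1}\left(\frac{1}{N+f(N)}\mu_N,dx\right)>\mathbf{W}_1^{1,1}\left(\frac{1}{N+f(N)}(-\mu_N),dx\right).$$
   Context: Here $\mathbb{N}=\{0,1,2,\dots\}$. $\operatorname{dist}$ is the Riemannian distance on $X$ and $dx$ is the Riemannian volume measure normalized so that $dx(X)=1$. $\delta_p$ is the Dirac measure at $p$. The points $x_i$ are our shops and the points $y_j$ are the rival's shops; the rival is allowed to choose the $y_j$ depending on the $x_i$, and points may coincide. $\mathcal M(X)$ is the set of positive finite measures on $X$, and $\mathcal M^s(X)$ the set of signed finite measures on $X$. For $\mu\in\mathcal M^s(X)$ with Jordan decomposition $\mu=\mu_+-\mu_-$, the total mass is $|\mu|:=\mu_+(X)+\mu_-(X)$. For $\mu,\nu\in\mathcal M(X)$ with $|\mu|=|\nu|$, $W_1(\mu,\nu)=\min_\pi\int_{X\times X}\operatorname{dist}(x,y)\,d\pi(x,y)$, the minimum being over positive finite measures $\pi$ on $X\times X$ with marginals $\mu$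 and $\nu$. For $\mu,\nu\in\mathcal M(X)$ (possibly of different mass), $$W_1^{1,1}(\mu,\nu)=\inf_{\tilde\mu,\tilde\nu\in\mathcal M(X),\ |\tilde\mu|=|\tilde\nu|}\ |\mu-\tilde\mu|+|\nu-\tilde\nu|+W_1(\tilde\mu,\tilde\nu).$$ For $\mu,\nu\in\mathcal M^s(X)$, the signed Wasserstein distance is $\mathbf{W}_1^{1,1}(\mu,\nu):=W_1^{1,1}(\mu_++\nu_-,\ \mu_-+\nu_+)$. *)

theory Defs
  imports "HOL-Probability.Probability"
begin

section \<open>Smooth manifolds and Riemannian metrics\<close>

text \<open>A manifold is a whole type carrying a Hausdorff, second countable topology, together with a
  (not necessarily maximal) smooth atlas.  A chart is a pair of a domain and a coordinate map,
  whose values outside the domain are irrelevant.\<close>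

type_synonym ('a, 'd) chart = "'a set \<times> ('a \<Rightarrow> real ^ 'd)"

abbreviation chart_inv :: "('a, 'd::finite) chart \<Rightarrow> real ^ 'd \<Rightarrow> 'a" where
  "chart_inv c \<equiv> inv_into (fst c) (snd c)"

text \<open>Meaningful on open sets only; all iterated directional derivatives are taken.\<close>

primrec k_times_diff_on ::
  "nat \<Rightarrow> 'e::real_normed_vector set \<Rightarrow> ('e \<Rightarrow> 'f::real_normed_vector) \<Rightarrow> bool" where
  "k_times_diff_on 0 S h \<longleftrightarrow> continuous_on S h"
| "k_times_diff_on (Suc k) S h \<longleftrightarrow>
     (\<forall>z\<in>S. h differentiable (at z)) \<and>
     (\<forall>v. k_times_diff_on k S (\<lambda>z. frechet_derivative h (at z) v))"

definition smooth_on :: "'e::real_normed_vector set \<Rightarrow> ('e \<Rightarrow> 'f::real_normed_vector) \<Rightarrow> bool" where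
  "smooth_on S h \<longleftrightarrow> (\<forall>k. k_times_diff_on k S h)"

definition smooth_atlas :: "('a::topological_space, 'd::finite) chart set \<Rightarrow> bool" where
  "smooth_atlas A \<longleftrightarrow>
     (\<Union>c\<in>A. fst c) = UNIV \<and>
     (\<forall>c\<in>A. open (fst c) \<and> open (snd c ` fst c) \<and>
        homeomorphism (fst c) (snd c ` fst c) (snd c) (chart_inv c)) \<and>
     (\<forall>c\<in>A. \<forall>c'\<in>A. smooth_on (snd c ` (fst c \<inter> fst c')) (snd c' \<circ> chart_inv c))"

text \<open>A metric is given by its coordinate matrices: \<open>g c p\<close> is the Gram matrix at \<open>p\<close> of the
  coordinate vector fields of the chart \<open>c\<close>.  The last condition is the transformation rule of a
  covariant 2-tensor.\<close>

definition riemannian_metric ::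
  "('a::topological_space, 'd::finite) chart set \<Rightarrow>
   (('a, 'd) chart \<Rightarrow> 'a \<Rightarrow> real ^ 'd ^ 'd) \<Rightarrow> bool" where
  "riemannian_metric A g \<longleftrightarrow>
     (\<forall>c\<in>A. smooth_on (snd c ` fst c) (\<lambda>z. g c (chart_inv c z))) \<and>
     (\<forall>c\<in>A. \<forall>p\<in>fst c. transpose (g c p) = g c p \<and> (\<forall>v. v \<noteq> 0 \<longrightarrow> v \<bullet> (g c p *v v) > 0)) \<and>
     (\<forall>c\<in>A. \<forall>c'\<in>A. \<forall>p \<in> fst c \<inter> fst c'.
        let D = frechet_derivative (snd c' \<circ> chart_inv c) (at (snd c p))
        in \<forall>v w. v \<bullet> (g c p *v w) = D v \<bullet> (g c' p *v D w))"


section \<open>Riemannian distance and volume\<close>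

text \<open>\<open>S\<close> contains the break points; on closed subintervals between them the curve is
  continuously differentiable up to the (one-sided) end points.\<close>

definition piecewise_C1_curve ::
  "('a::topological_space, 'd::finite) chart set \<Rightarrow> (real \<Rightarrow> 'a) \<Rightarrow> bool" where
  "piecewise_C1_curve A \<gamma> \<longleftrightarrow>
     continuous_on {0..1} \<gamma> \<and>
     (\<exists>S. finite S \<and>
        (\<forall>c\<in>A. \<forall>a b. 0 \<le> a \<and> a < b \<and> b \<le> 1 \<and> {a<..<b} \<inter> S = {} \<and> \<gamma> ` {a..b} \<subseteq> fst c \<longrightarrow>
           (\<exists>D. continuous_on {a..b} D \<and>
              (\<forall>t\<in>{a..b}. ((snd c \<circ> \<gamma>) has_vector_derivative D t) (at t within {a..b})))))"

text \<open>The norm of the velocity; by the transformation rule the value is the same in every chart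
  around \<open>\<gamma> t\<close>.  At the finitely many break points the value is irrelevant.\<close>

definition speed ::
  "('a::topological_space, 'd::finite) chart set \<Rightarrow> (('a, 'd) chart \<Rightarrow> 'a \<Rightarrow> real ^ 'd ^ 'd) \<Rightarrow>
   (real \<Rightarrow> 'a) \<Rightarrow> real \<Rightarrow> real" where
  "speed A g \<gamma> t =
     (THE s. \<forall>c\<in>A. \<gamma> t \<in> fst c \<longrightarrow>
        (let v = vector_derivative (snd c \<circ> \<gamma>) (at t) in s = sqrt (v \<bullet> (g c (\<gamma> t) *v v))))"

definition curve_length ::
  "('a::topological_space, 'd::finite) chart set \<Rightarrow> (('a, 'd) chart \<Rightarrow> 'a \<Rightarrow> real ^ 'd ^ 'd) \<Rightarrow>
   (real \<Rightarrow> 'a) \<Rightarrow> ennreal" where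
  "curve_length A g \<gamma> = (\<integral>\<^sup>+ t\<in>{0..1}. ennreal (speed A g \<gamma> t) \<partial>lborel)"

text \<open>Infinite between different connected components.\<close>

definition riemannian_dist ::
  "('a::topological_space, 'd::finite) chart set \<Rightarrow> (('a, 'd) chart \<Rightarrow> 'a \<Rightarrow> real ^ 'd ^ 'd) \<Rightarrow>
   'a \<Rightarrow> 'a \<Rightarrow> ennreal" where
  "riemannian_dist A g p q =
     (INF \<gamma>\<in>{\<gamma>. piecewise_C1_curve A \<gamma> \<and> \<gamma> 0 = p \<and> \<gamma> 1 = q}. curve_length A g \<gamma>)"

text \<open>The Borel measure with density \<open>sqrt (det g)\<close> in every chart.  These conditions determine
  it uniquely, the manifold being covered by countably many charts.\<close>

definition riemannian_volume ::
  "('a::topological_space, 'd::finite) chart set \<Rightarrow> (('a, 'd) chart \<Rightarrow> 'a \<Rightarrow> real ^ 'd ^ 'd) \<Rightarrow>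
   'a measure \<Rightarrow> bool" where
  "riemannian_volume A g vol \<longleftrightarrow>
     sets vol = sets borel \<and>
     (\<forall>c\<in>A. \<forall>B\<in>sets borel. B \<subseteq> fst c \<longrightarrow>
        emeasure vol B = (\<integral>\<^sup>+ z\<in>snd c ` B. ennreal (sqrt (det (g c (chart_inv c z)))) \<partial>lborel))"

definition normalized :: "'a measure \<Rightarrow> 'a measure" where
  "normalized M = scale_measure (inverse (emeasure M (space M))) M"


section \<open>Signed measures\<close>

definition finite_borel_measure :: "'a::topological_space measure \<Rightarrow> bool" where
  "finite_borel_measure M \<longleftrightarrow> sets M = sets borel \<and> finite_measure M"

definition add_measure ::
  "'a::topological_space measure \<Rightarrow> 'a measure \<Rightarrow> 'a measure" where
  "add_measure M N = measure_of UNIV (sets borel) (\<lambda>E. emeasure M E + emeasure N E)"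

text \<open>A finite signed Borel measure is represented by its set function, of which only the values
  on Borel sets matter.  A positive finite measure \<open>M\<close> becomes \<open>measure M\<close>.\<close>

definition jordan_decomposition ::
  "('a::topological_space set \<Rightarrow> real) \<Rightarrow> 'a measure \<Rightarrow> 'a measure \<Rightarrow> bool" where
  "jordan_decomposition s P N \<longleftrightarrow>
     finite_borel_measure P \<and> finite_borel_measure N \<and>
     (\<forall>E\<in>sets borel. s E = measure P E - measure N E) \<and>
     (\<exists>H\<in>sets borel. emeasure P (- H) = 0 \<and> emeasure N H = 0)"

definition jordan_pos :: "('a::topological_space set \<Rightarrow> real) \<Rightarrow> 'a measure" where
  "jordan_pos s = (THE P. \<exists>N. jordan_decomposition s P N)"

definition jordan_neg :: "('a::topological_space set \<Rightarrow> real) \<Rightarrow> 'a measure" where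
  "jordan_neg s = (THE N. \<exists>P. jordan_decomposition s P N)"

definition total_mass :: "('a::topological_space set \<Rightarrow> real) \<Rightarrow> ennreal" where
  "total_mass s = emeasure (jordan_pos s) UNIV + emeasure (jordan_neg s) UNIV"


section \<open>Wasserstein distances\<close>

text \<open>The ground distance \<open>d\<close> is a parameter.\<close>

definition couplings ::
  "'a::topological_space measure \<Rightarrow> 'a measure \<Rightarrow> ('a \<times> 'a) measure set" where
  "couplings M N =
     {\<pi>. finite_borel_measure \<pi> \<and> distr \<pi> borel fst = M \<and> distr \<pi> borel snd = N}"

definition wasserstein1 ::
  "('a::topological_space \<Rightarrow> 'a \<Rightarrow> ennreal) \<Rightarrow> 'a measure \<Rightarrow> 'a measure \<Rightarrow> ennreal" where
  "wasserstein1 d M N = (INF \<pi>\<in>couplings M N. \<integral>\<^sup>+ (x, y). d x y \<partial>\<pi>)"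

definition gen_wasserstein ::
  "('a::topological_space \<Rightarrow> 'a \<Rightarrow> ennreal) \<Rightarrow> 'a measure \<Rightarrow> 'a measure \<Rightarrow> ennreal" where
  "gen_wasserstein d M N =
     (INF (M', N')\<in>{(M', N'). finite_borel_measure M' \<and> finite_borel_measure N' \<and>
                        emeasure M' UNIV = emeasure N' UNIV}.
        total_mass (\<lambda>E. measure M E - measure M' E) +
        total_mass (\<lambda>E. measure N E - measure N' E) +
        wasserstein1 d M' N')"

definition signed_wasserstein ::
  "('a::topological_space \<Rightarrow> 'a \<Rightarrow> ennreal) \<Rightarrow> ('a set \<Rightarrow> real) \<Rightarrow> ('a set \<Rightarrow> real) \<Rightarrow> ennreal" where
  "signed_wasserstein d s t =
     gen_wasserstein d (add_measure (jordan_pos s) (jordan_neg t))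
                       (add_measure (jordan_neg s) (jordan_pos t))"

definition shop_measure ::
  "(nat \<Rightarrow> nat) \<Rightarrow> (nat \<Rightarrow> 'a::topological_space) \<Rightarrow> (nat \<Rightarrow> 'a) \<Rightarrow> nat \<Rightarrow> 'a set \<Rightarrow> real" where
  "shop_measure f x y N E =
     (\<Sum>i=1..N. measure (return borel (x i)) E) - (\<Sum>j=1..f N. measure (return borel (y j)) E)"

end

theory Submission
  imports Defs
begin

text \<open>The rival copies us: \<open>y = x\<close>.  Then \<open>\<mu>\<^sub>N\<close> is minus a sum of \<open>f N - N \<ge> N\<close> Dirac masses, so
  \<open>\<mu>\<^sub>N / (N + f N) = - M\<close> with \<open>M \<noteq> 0\<close> positive.  The distance of \<open>- M\<close> to the volume is the
  generalized distance of \<open>0\<close> to \<open>M + dx\<close>, where nothing can be transported, and hence equals the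
  full mass \<open>|M| + 1\<close>.  The distance of \<open>M\<close> to the volume is strictly smaller: instead of deleting
  everything, transport a little mass from an atom of \<open>M\<close> to the volume of a small ball around
  it, at cost at most 1 per unit instead of 2.\<close>

section \<open>Small neighbourhoods in a Riemannian manifold\<close>

text \<open>Every matrix on the segment from the identity to \<open>M\<close> is positive definite,
  hence has trivial kernel. So the determinant has no zero on the segment and keeps the sign it has
  at the identity. This makes the volume density positive.\<close>

lemma det_pos_if_positive_definite:
  fixes M :: "real ^ 'n ^ 'n"
  assumes pos: "\<And>v. v \<noteq> 0 \<Longrightarrow> v \<bullet> (M *v v) > 0"
  shows "det M > 0"
proof (rule ccontr)
  assume "\<not> det M > 0"
  define q where "q t = det ((1 - t) *\<^sub>R mat 1 + t *\<^sub>R M)" for t :: real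
  have "continuous_on {0..1} q"
    unfolding q_def det_def by (intro continuous_intros)
  moreover have "q 0 = 1" "q 1 \<le> 0"
    using \<open>\<not> det M > 0\<close> by (simp_all add: q_def)
  ultimately obtain t where t: "0 \<le> t" "t \<le> 1" "q t = 0"
    using IVT2'[of q 1 0 0] by force
  then obtain v where v: "v \<noteq> 0" "((1 - t) *\<^sub>R mat 1 + t *\<^sub>R M) *v v = 0"
    using matrix_left_invertible_ker invertible_left_inverse invertible_det_nz
    unfolding q_def by blast
  then have "v \<bullet> (((1 - t) *\<^sub>R mat 1 + t *\<^sub>R M) *v v) = 0"
    by simp
  then have "(1 - t) * (v \<bullet> v) + t * (v \<bullet> (M *v v)) = 0"
    by (simp add: matrix_vector_mult_add_rdistrib scaleR_matrix_vector_assoc[symmetric]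
        inner_add_right)
  moreover have "v \<bullet> v > 0" "v \<bullet> (M *v v) > 0"
    using v pos by auto
  ultimately show False
    using t by (smt (verit) mult_nonneg_nonneg mult_pos_pos)
qed

section \<open>Coordinate segments as curves\<close>

lemma transition_has_derivative:
  assumes "smooth_atlas A" "c \<in> A" "c' \<in> A" "z \<in> snd c ` (fst c \<inter> fst c')"
  shows "((snd c' \<circ> chart_inv c) has_derivative frechet_derivative (snd c' \<circ> chart_inv c) (at z)) (at z)"
proof -
  have "k_times_diff_on (Suc 0) (snd c ` (fst c \<inter> fst c')) (snd c' \<circ> chart_inv c)"
    using assms unfolding smooth_atlas_def smooth_on_def by blast
  then show ?thesis
    using assms(4) frechet_derivative_works by auto
qed

lemma continuous_on_transition_derivative:
  assumes "smooth_atlas A" "c \<in> A" "c' \<in> A"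
  shows "continuous_on (snd c ` (fst c \<inter> fst c'))
           (\<lambda>z. frechet_derivative (snd c' \<circ> chart_inv c) (at z) v)"
proof -
  have "k_times_diff_on (Suc 0) (snd c ` (fst c \<inter> fst c')) (snd c' \<circ> chart_inv c)"
    using assms unfolding smooth_atlas_def smooth_on_def by blast
  then show ?thesis by simp
qed

text \<open>The set \<open>T\<close> is left free because the lemma serves twice: with an interval
  for piecewise smoothness, and with the whole line for the two-sided
  \<open>vector_derivative\<close> in \<open>speed\<close>.\<close>

lemma chart_segment_vector_derivative:
  fixes z w :: "real ^ 'd"
  assumes "smooth_atlas A" "c \<in> A" "c' \<in> A"
    and "z + t *\<^sub>R w \<in> snd c ` (fst c \<inter> fst c')"
  shows "((snd c' \<circ> (\<lambda>t. chart_inv c (z + t *\<^sub>R w))) has_vector_derivative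
           frechet_derivative (snd c' \<circ> chart_inv c) (at (z + t *\<^sub>R w)) w) (at t within T)"
proof -
  have "((\<lambda>t. z + t *\<^sub>R w) has_derivative (\<lambda>h. h *\<^sub>R w)) (at t within T)"
    by (auto intro!: derivative_eq_intros)
  from has_derivative_compose[OF this transition_has_derivative[OF assms]]
  show ?thesis
    unfolding has_vector_derivative_def o_def
    by (simp add: linear_cmul[OF has_derivative_linear[OF transition_has_derivative[OF assms]], unfolded o_def])
qed

text \<open>The pullback of a straight segment is an admissible curve, run through in unit time with
  speed at most \<open>L\<close>. The work lies in the other charts, since
  \<open>piecewise_C1_curve\<close> and \<open>speed\<close> both quantify over the whole
  atlas.\<close>

lemma riemannian_dist_chart_segment_le:
  fixes A :: "('a::topological_space, 'd::finite) chart set" and z w :: "real ^ 'd"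
  assumes atlas: "smooth_atlas A" and metric: "riemannian_metric A g" and c: "c \<in> A"
    and seg: "\<And>t. t \<in> {0..1} \<Longrightarrow> z + t *\<^sub>R w \<in> snd c ` fst c"
    and bound: "\<And>t. t \<in> {0..1} \<Longrightarrow>
      sqrt (w \<bullet> (g c (chart_inv c (z + t *\<^sub>R w)) *v w)) \<le> L"
  shows "riemannian_dist A g (chart_inv c z) (chart_inv c (z + w)) \<le> ennreal L"
proof -
  define \<gamma> where "\<gamma> = (\<lambda>t. chart_inv c (z + t *\<^sub>R w))"
  have hom: "homeomorphism (fst c) (snd c ` fst c) (snd c) (chart_inv c)"
    using atlas c by (auto simp: smooth_atlas_def)
  have \<gamma>_in: "\<gamma> t \<in> fst c" and \<phi>\<gamma>: "snd c (\<gamma> t) = z + t *\<^sub>R w" if "t \<in> {0..1}" for t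
    using seg[OF that] hom by (auto simp: \<gamma>_def homeomorphism_def)
  have overlap: "z + t *\<^sub>R w \<in> snd c ` (fst c \<inter> fst c')"
    if "t \<in> {0..1}" "\<gamma> t \<in> fst c'" for t c'
    using \<gamma>_in[OF that(1)] \<phi>\<gamma>[OF that(1)] that(2) by (metis IntI image_eqI)
  have "continuous_on {0..1} \<gamma>"
    unfolding \<gamma>_def
    by (rule continuous_on_compose2[OF homeomorphism_cont2[OF hom]])
       (use seg in \<open>auto intro!: continuous_intros\<close>)
  \<comment> \<open>In the chart \<open>c'\<close> the velocity is the transition derivative applied
    to \<open>w\<close>, which varies continuously along the whole segment. The set of break points
    can therefore be empty.\<close>
  moreover have "\<exists>D. continuous_on {a..b} D \<and>
      (\<forall>t\<in>{a..b}. ((snd c' \<circ> \<gamma>) has_vector_derivative D t) (at t within {a..b}))"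
    if "c' \<in> A" "0 \<le> a" "b \<le> 1" "\<gamma> ` {a..b} \<subseteq> fst c'" for c' a b
  proof (intro exI conjI ballI)
    let ?D = "\<lambda>t. frechet_derivative (snd c' \<circ> chart_inv c) (at (z + t *\<^sub>R w)) w"
    have sub: "z + t *\<^sub>R w \<in> snd c ` (fst c \<inter> fst c')" if "t \<in> {a..b}" for t
      by (rule overlap) (use that \<open>0 \<le> a\<close> \<open>b \<le> 1\<close> \<open>\<gamma> ` {a..b} \<subseteq> fst c'\<close> in auto)
    show "continuous_on {a..b} ?D"
      by (rule continuous_on_compose2[OF
            continuous_on_transition_derivative[OF atlas c \<open>c' \<in> A\<close>]])
         (use sub in \<open>auto intro!: continuous_intros\<close>)
    show "((snd c' \<circ> \<gamma>) has_vector_derivative ?D t) (at t within {a..b})" if "t \<in> {a..b}" for t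
      unfolding \<gamma>_def
      by (rule chart_segment_vector_derivative[OF atlas c \<open>c' \<in> A\<close> sub[OF that]])
  qed
  ultimately have curve: "piecewise_C1_curve A \<gamma>"
    unfolding piecewise_C1_curve_def by (auto intro!: exI[of _ "{}"])
  have speed: "speed A g \<gamma> t = sqrt (w \<bullet> (g c (\<gamma> t) *v w))" if t: "t \<in> {0..1}" for t
  proof -
    let ?s = "sqrt (w \<bullet> (g c (\<gamma> t) *v w))"
    \<comment> \<open>The transformation rule of the metric makes the definite description in
      \<open>speed\<close> meaningful: every chart around the point returns the value computed in
      \<open>c\<close>, and \<open>c\<close> itself pins that value down.\<close>
    have eq: "(let v = vector_derivative (snd c' \<circ> \<gamma>) (at t) in sqrt (v \<bullet> (g c' (\<gamma> t) *v v))) = ?s"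
      if "c' \<in> A" "\<gamma> t \<in> fst c'" for c'
    proof -
      have "vector_derivative (snd c' \<circ> \<gamma>) (at t) =
          frechet_derivative (snd c' \<circ> chart_inv c) (at (snd c (\<gamma> t))) w"
        unfolding \<phi>\<gamma>[OF t] unfolding \<gamma>_def
        by (rule vector_derivative_at)
           (rule chart_segment_vector_derivative[OF atlas c that(1) overlap[OF t that(2)]])
      moreover have "\<gamma> t \<in> fst c \<inter> fst c'"
        using \<gamma>_in[OF t] that by simp
      ultimately show ?thesis
        using metric c that(1) unfolding riemannian_metric_def Let_def by metis
    qed
    show ?thesis
      unfolding speed_def Let_def
    proof (rule the_equality)
      show "\<forall>c'\<in>A. \<gamma> t \<in> fst c' \<longrightarrow> ?s = sqrt (vector_derivative (snd c' \<circ> \<gamma>) (at t) \<bullet>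
          (g c' (\<gamma> t) *v vector_derivative (snd c' \<circ> \<gamma>) (at t)))"
        using eq unfolding Let_def by simp
      show "s = ?s" if "\<forall>c'\<in>A. \<gamma> t \<in> fst c' \<longrightarrow> s = sqrt (vector_derivative (snd c' \<circ> \<gamma>) (at t) \<bullet>
          (g c' (\<gamma> t) *v vector_derivative (snd c' \<circ> \<gamma>) (at t)))" for s
        using that eq[OF c \<gamma>_in[OF t]] c \<gamma>_in[OF t] unfolding Let_def by metis
    qed
  qed
  have "riemannian_dist A g (chart_inv c z) (chart_inv c (z + w)) \<le> curve_length A g \<gamma>"
    unfolding riemannian_dist_def by (rule INF_lower) (use curve in \<open>simp add: \<gamma>_def\<close>)
  also have "\<dots> \<le> (\<integral>\<^sup>+ t\<in>{0..1::real}. ennreal L \<partial>lborel)"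
    unfolding curve_length_def
    by (rule nn_integral_mono)
       (use bound speed in \<open>auto simp: indicator_def \<gamma>_def intro!: ennreal_leI\<close>)
  also have "\<dots> = ennreal L"
    by (simp add: nn_integral_cmult_indicator)
  finally show ?thesis .
qed

section \<open>Small coordinate balls and the total volume\<close>

text \<open>A small coordinate ball around \<open>p\<close> does it. Bounds from both sides on the
  density make its volume positive and finite, and smallness of the metric on short vectors keeps
  the length of radial segments at most 1.\<close>

lemma chart_neighbourhood:
  fixes A :: "('a::topological_space, 'd::finite) chart set" and p :: 'a
  assumes atlas: "smooth_atlas A" and metric: "riemannian_metric A g"
    and vol: "riemannian_volume A g vol"
  obtains U where "open U" "p \<in> U" "0 < emeasure vol U" "emeasure vol U < \<infinity>"
    "\<And>q. q \<in> U \<Longrightarrow> riemannian_dist A g p q \<le> 1"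
proof -
  obtain c where c: "c \<in> A" "p \<in> fst c"
    using atlas unfolding smooth_atlas_def by blast
  define V where "V = snd c ` fst c"
  define G where "G z = g c (chart_inv c z)" for z
  have V: "open V" "open (fst c)" and hom: "homeomorphism (fst c) V (snd c) (chart_inv c)"
    using atlas c by (auto simp: smooth_atlas_def V_def)
  have "k_times_diff_on 0 V G"
    using metric c unfolding riemannian_metric_def smooth_on_def V_def G_def by blast
  then have G: "continuous_on V G" by simp
  define z0 where "z0 = snd c p"
  have z0: "z0 \<in> V" and p: "chart_inv c z0 = p"
    using c hom by (auto simp: z0_def V_def homeomorphism_def)
  define k where "k = det (G z0)"
  have "k > 0"
    unfolding k_def G_def p
    by (rule det_pos_if_positive_definite) (use metric c in \<open>auto simp: riemannian_metric_def\<close>)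

  have "continuous_on V (\<lambda>z. det (G z))"
    unfolding det_def by (intro continuous_intros G)
  then have "isCont (\<lambda>z. det (G z)) z0"
    using V(1) z0 continuous_on_eq_continuous_at by blast
  then have "\<forall>\<^sub>F z in at z0. det (G z) \<in> {k/2<..<2*k}"
    unfolding isCont_def by (rule topological_tendstoD) (use \<open>k > 0\<close> in \<open>auto simp: k_def\<close>)
  then obtain d1 where d1: "d1 > 0"
      "\<And>z. z \<noteq> z0 \<Longrightarrow> dist z z0 < d1 \<Longrightarrow> det (G z) \<in> {k/2<..<2*k}"
    unfolding eventually_at by auto
  \<comment> \<open>\<open>eventually_at\<close> only covers a punctured neighbourhood; at the
    centre the determinant is \<open>k\<close> itself, which lies in the window since
    \<open>k > 0\<close>.\<close>
  have det_in: "det (G z) \<in> {k/2<..<2*k}" if "dist z z0 < d1" for z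
    using d1(2)[of z] that \<open>k > 0\<close> by (cases "z = z0") (auto simp: k_def)

  \<comment> \<open>The quadratic form is jointly continuous in base point and vector and vanishes
    at \<open>(z0, 0)\<close>. One neighbourhood of that pair thus bounds it by 1 uniformly for
    nearby base points and short vectors.\<close>
  have "continuous_on (V \<times> UNIV) (\<lambda>x. snd x \<bullet> (G (fst x) *v snd x))"
    unfolding matrix_vector_mult_def
    by (intro continuous_intros continuous_on_compose2[OF G]) auto
  then have "isCont (\<lambda>x. snd x \<bullet> (G (fst x) *v snd x)) (z0, 0)"
    using V(1) z0 continuous_on_eq_continuous_at[of "V \<times> UNIV"] by (auto simp: open_Times)
  then have "\<forall>\<^sub>F x in at (z0, 0). snd x \<bullet> (G (fst x) *v snd x) < 1"
    unfolding isCont_def by (rule order_tendstoD) simp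
  then obtain d2 where d2: "d2 > 0" "\<And>x. x \<noteq> (z0, 0) \<Longrightarrow> dist x (z0, 0) < d2 \<Longrightarrow>
      snd x \<bullet> (G (fst x) *v snd x) < 1"
    unfolding eventually_at by auto
  have form_less: "w \<bullet> (G z *v w) < 1" if "dist z z0 < d2 / 2" "norm w < d2 / 2" for z w
  proof (cases "(z, w) = (z0, 0)")
    case False
    have "dist (z, w) (z0, 0) \<le> dist z z0 + norm w"
      unfolding dist_Pair_Pair by (simp add: sqrt_sum_squares_le_sum)
    then have "dist (z, w) (z0, 0) < d2" using that by linarith
    from d2(2)[OF False this] show ?thesis by simp
  qed simp

  obtain d3 where d3: "d3 > 0" "ball z0 d3 \<subseteq> V"
    using V(1) z0 open_contains_ball by blast
  \<comment> \<open>\<open>d1\<close> controls the density, \<open>d3\<close> keeps the ball inside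
    the chart, and \<open>d2 / 2\<close> bounds both the base point and the displacement, so that
    the pair stays within \<open>d2\<close> of \<open>(z0, 0)\<close>.\<close>
  define r where "r = min d1 (min (d2 / 2) d3)"
  have r: "r > 0" "r \<le> d1" "r \<le> d2 / 2" "r \<le> d3"
    using d1(1) d2(1) d3(1) by (auto simp: r_def)
  have rV: "ball z0 r \<subseteq> V"
    using d3(2) r(4) subset_ball by blast
  define U where "U = chart_inv c ` ball z0 r"
  have UV: "U \<subseteq> fst c" and \<phi>U: "snd c ` U = ball z0 r"
    using rV hom unfolding U_def homeomorphism_def by (auto simp: image_image subset_iff)
  have "openin (top_of_set (fst c)) U"
    using homeomorphism_imp_open_map[OF homeomorphism_symD[OF hom], of "ball z0 r"] rV
    by (simp add: U_def openin_open_eq[OF V(1)])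
  then have "open U"
    using V(2) by (simp add: openin_open_eq)
  have density: "sqrt (k/2) \<le> sqrt (det (G z))" "sqrt (det (G z)) \<le> sqrt (2*k)"
    if "z \<in> ball z0 r" for z
    using det_in[of z] that r(2) by (auto simp: dist_commute)
  have "emeasure vol U = (\<integral>\<^sup>+ z\<in>ball z0 r. ennreal (sqrt (det (G z))) \<partial>lborel)"
  proof -
    have "\<forall>B\<in>sets borel. B \<subseteq> fst c \<longrightarrow> emeasure vol B =
        (\<integral>\<^sup>+ z\<in>snd c ` B. ennreal (sqrt (det (g c (chart_inv c z)))) \<partial>lborel)"
      using vol c(1) unfolding riemannian_volume_def by blast
    from bspec[OF this borel_open[OF \<open>open U\<close>]] UV show ?thesis
      by (simp add: G_def \<phi>U)
  qed
  moreover have "(\<integral>\<^sup>+ z\<in>ball z0 r. ennreal (sqrt (k/2)) \<partial>lborel) \<le> \<dots>"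
    by (rule nn_integral_mono) (use density in \<open>auto simp: indicator_def intro!: ennreal_leI\<close>)
  moreover have "(\<integral>\<^sup>+ z\<in>ball z0 r. ennreal (sqrt (det (G z))) \<partial>lborel) \<le>
      (\<integral>\<^sup>+ z\<in>ball z0 r. ennreal (sqrt (2*k)) \<partial>lborel)"
    by (rule nn_integral_mono) (use density in \<open>auto simp: indicator_def intro!: ennreal_leI\<close>)
  ultimately have "ennreal (sqrt (k/2)) * emeasure lborel (ball z0 r) \<le> emeasure vol U"
    "emeasure vol U \<le> ennreal (sqrt (2*k)) * emeasure lborel (ball z0 r)"
    by (simp_all add: nn_integral_cmult_indicator)
  moreover have "0 < ennreal (sqrt (k/2)) * emeasure lborel (ball z0 r)"
    using \<open>k > 0\<close> content_ball_pos[OF r(1), of z0]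
    by (auto simp: ennreal_zero_less_mult_iff measure_def zero_less_iff_neq_zero)
  moreover have "ennreal (sqrt (2*k)) * emeasure lborel (ball z0 r) < \<infinity>"
    using emeasure_lborel_ball_finite[of z0 r] by (simp add: ennreal_mult_less_top)
  ultimately have "0 < emeasure vol U" "emeasure vol U < \<infinity>"
    by (auto intro: order.strict_trans1 order.strict_trans2)
  moreover have "riemannian_dist A g p q \<le> 1" if "q \<in> U" for q
  proof -
    obtain z where z: "z \<in> ball z0 r" "q = chart_inv c z"
      using \<open>q \<in> U\<close> by (auto simp: U_def)
    have near: "dist (z0 + t *\<^sub>R (z - z0)) z0 < r" if "t \<in> {0..1}" for t
    proof -
      have "dist (z0 + t *\<^sub>R (z - z0)) z0 = t * dist z0 z"
        using that by (simp add: dist_norm norm_minus_commute)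
      also have "\<dots> \<le> dist z0 z"
        using that by (simp add: mult_left_le_one_le)
      finally show ?thesis using z by simp
    qed
    have "riemannian_dist A g (chart_inv c z0) (chart_inv c (z0 + (z - z0))) \<le> ennreal 1"
    proof (rule riemannian_dist_chart_segment_le[OF atlas metric c(1)])
      fix t :: real assume t: "t \<in> {0..1}"
      show "z0 + t *\<^sub>R (z - z0) \<in> snd c ` fst c"
        using near[OF t] rV by (auto simp: dist_commute V_def)
      have "norm (z - z0) < d2 / 2"
        using z r by (simp add: dist_norm norm_minus_commute)
      then have "(z - z0) \<bullet> (G (z0 + t *\<^sub>R (z - z0)) *v (z - z0)) < 1"
        using near[OF t] r by (intro form_less) auto
      then show "sqrt ((z - z0) \<bullet> (g c (chart_inv c (z0 + t *\<^sub>R (z - z0))) *v (z - z0))) \<le> 1"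
        by (simp add: G_def)
    qed
    then show ?thesis by (simp add: p z)
  qed
  moreover have "p \<in> U"
    using r(1) p by (force simp: U_def)
  ultimately show ?thesis using that \<open>open U\<close> by blast
qed

text \<open>By compactness finitely many neighbourhoods of finite volume cover the manifold.\<close>

lemma riemannian_volume_finite:
  fixes A :: "('a::topological_space, 'd::finite) chart set"
  assumes "compact (UNIV :: 'a set)" "smooth_atlas A" "riemannian_metric A g"
    "riemannian_volume A g vol"
  shows "emeasure vol UNIV < \<infinity>"
proof -
  let ?C = "{U. open U \<and> emeasure vol U < \<infinity>}"
  have "UNIV \<subseteq> \<Union>?C"
  proof
    fix p :: 'a
    show "p \<in> \<Union>?C"
      by (rule chart_neighbourhood[OF assms(2-4), of p]) auto
  qed
  with assms(1) obtain F where F: "F \<subseteq> ?C" "finite F" "UNIV \<subseteq> \<Union>F"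
    by (rule compactE) auto
  have "sets vol = sets borel" using assms(4) by (simp add: riemannian_volume_def)
  then have "emeasure vol (\<Union>U\<in>F. U) \<le> (\<Sum>U\<in>F. emeasure vol U)"
    using F by (intro emeasure_subadditive_finite) auto
  also have "\<dots> < \<infinity>" using F by (auto simp: less_top)
  finally show ?thesis using F(3) by (simp add: top.extremum_unique)
qed


section \<open>Signed measures and generalized Wasserstein distances\<close>

lemma finite_borel_measureD:
  assumes "finite_borel_measure M"
  shows "sets M = sets borel" "finite_measure M" "space M = UNIV"
    "emeasure M E = ennreal (measure M E)"
  using assms sets_eq_imp_space_eq[of M borel]
  by (auto simp: finite_borel_measure_def finite_measure.emeasure_eq_measure)

lemma finite_borel_measure_null [simp]: "finite_borel_measure (null_measure borel)"
  by (simp add: finite_borel_measure_def finite_measureI)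

lemma finite_borel_measure_eqI:
  assumes "finite_borel_measure M" "finite_borel_measure N"
    and "\<And>E. E \<in> sets borel \<Longrightarrow> measure M E = measure N E"
  shows "M = N"
  by (rule measure_eqI) (use assms in \<open>simp_all add: finite_borel_measureD\<close>)

text \<open>\<open>measure_of\<close> returns the intended values only once the set function is
  known to be countably additive.\<close>

lemma emeasure_add_measure:
  fixes M N :: "'a::topological_space measure"
  assumes "sets M = sets borel" "sets N = sets borel" "E \<in> sets borel"
  shows "emeasure (add_measure M N) E = emeasure M E + emeasure N E"
  unfolding add_measure_def
proof (rule emeasure_measure_of_sigma)
  show "sigma_algebra UNIV (sets borel)"
    using sets.sigma_algebra_axioms[of borel] by simp
  show "countably_additive (sets borel) (\<lambda>E. emeasure M E + emeasure N E)"
  proof (rule countably_additiveI)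
    fix B :: "nat \<Rightarrow> 'a set" assume B: "range B \<subseteq> sets borel" "disjoint_family B"
    have "(\<Sum>i. emeasure M (B i) + emeasure N (B i)) =
        (\<Sum>i. emeasure M (B i)) + (\<Sum>i. emeasure N (B i))"
      by (rule suminf_add[symmetric]) auto
    then show "(\<Sum>i. emeasure M (B i) + emeasure N (B i)) =
        emeasure M (\<Union>i. B i) + emeasure N (\<Union>i. B i)"
      using B assms(1,2) by (simp add: suminf_emeasure)
  qed
qed (use assms in \<open>auto simp: positive_def\<close>)

lemma sets_add_measure [simp]: "sets (add_measure M N) = sets borel"
  unfolding add_measure_def using sets.sigma_sets_eq[of borel] by (simp add: sets_measure_of_conv)

lemma finite_borel_measure_add:
  assumes "finite_borel_measure M" "finite_borel_measure N"
  shows "finite_borel_measure (add_measure M N)"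
  unfolding finite_borel_measure_def
proof
  have "space (add_measure M N) = UNIV"
    using sets_eq_imp_space_eq[OF sets_add_measure[of M N]] by simp
  then show "finite_measure (add_measure M N)"
    by (intro finite_measureI)
       (simp add: emeasure_add_measure finite_borel_measureD[OF assms(1)] finite_borel_measureD[OF assms(2)])
qed simp

lemma add_measure_null:
  assumes "sets M = sets borel"
  shows "add_measure M (null_measure borel) = M" "add_measure (null_measure borel) M = M"
  by (rule measure_eqI; use assms in \<open>simp add: emeasure_add_measure\<close>)+


section \<open>Jordan decompositions and total mass\<close>

text \<open>The complement of the Hahn set serves for the negated function. This carries uniqueness
  over from positive to negative parts.\<close>

lemma jordan_decomposition_uminus:
  "jordan_decomposition s P N \<Longrightarrow> jordan_decomposition (\<lambda>E. - s E) N P"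
  unfolding jordan_decomposition_def
  by (metis boolean_algebra_class.boolean_algebra.double_compl borel_comp minus_diff_eq)

text \<open>On a Hahn set \<open>H\<close> of the first decomposition the positive part is the largest value of \<open>s\<close>.\<close>

lemma jordan_decomposition_pos_le:
  assumes "jordan_decomposition s P N" "jordan_decomposition s P' N'" "E \<in> sets borel"
  shows "measure P E \<le> measure P' E"
proof -
  have fin: "finite_borel_measure P" "finite_borel_measure N" "finite_borel_measure P'"
    and sN: "\<And>E. E \<in> sets borel \<Longrightarrow> s E = measure P E - measure N E"
    and sN': "\<And>E. E \<in> sets borel \<Longrightarrow> s E = measure P' E - measure N' E"
    using assms by (auto simp: jordan_decomposition_def)
  note sets_eq [simp] = fin[THEN finite_borel_measureD(1)]
  obtain H where H: "H \<in> sets borel" "emeasure P (- H) = 0" "emeasure N H = 0"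
    using assms(1) by (auto simp: jordan_decomposition_def)
  have "measure P E = measure P (E \<inter> H)"
  proof -
    have "emeasure P (E \<inter> H) = emeasure P E"
      by (rule emeasure_eq_AE)
         (use H assms(3) in \<open>auto intro!: AE_I[of _ _ "- H"]\<close>)
    then show ?thesis by (simp add: measure_def)
  qed
  also have "measure N (E \<inter> H) = 0"
    using emeasure_mono[of "E \<inter> H" H N] H by (simp add: measure_def)
  then have "measure P (E \<inter> H) = s (E \<inter> H)"
    using sN[of "E \<inter> H"] H assms(3) by simp
  also have "\<dots> \<le> measure P' (E \<inter> H)"
    using sN'[of "E \<inter> H"] H assms(3) by simp
  also have "\<dots> \<le> measure P' E"
    using fin(3) assms(3) by (intro finite_measure.finite_measure_mono) (auto simp: finite_borel_measureD)
  finally show ?thesis .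
qed

lemma jordan_decomposition_pos_unique:
  assumes "jordan_decomposition s P N" "jordan_decomposition s P' N'"
  shows "P = P'"
proof (rule finite_borel_measure_eqI)
  show "finite_borel_measure P" "finite_borel_measure P'"
    using assms by (simp_all add: jordan_decomposition_def)
  show "measure P E = measure P' E" if "E \<in> sets borel" for E
    using jordan_decomposition_pos_le[OF assms that] jordan_decomposition_pos_le[OF assms(2,1) that]
    by simp
qed

lemma jordan_eqI:
  assumes "jordan_decomposition s P N"
  shows "jordan_pos s = P" "jordan_neg s = N"
  unfolding jordan_pos_def jordan_neg_def
  using assms jordan_decomposition_pos_unique jordan_decomposition_uminus
  by (blast intro: the_equality)+

lemma jordan_decomposition_measure:
  assumes "finite_borel_measure M" "\<And>E. E \<in> sets borel \<Longrightarrow> s E = measure M E"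
  shows "jordan_decomposition s M (null_measure borel)"
  using assms unfolding jordan_decomposition_def by (auto intro!: bexI[of _ UNIV])

text \<open>On a Hahn set \<open>Y\<close>, where \<open>M\<close> dominates \<open>N\<close>, the
  positive part is \<open>M - N\<close>; off \<open>Y\<close> the negative part is
  \<open>N - M\<close>.\<close>

lemma jordan_decomposition_exists:
  fixes M N :: "'a::topological_space measure"
  assumes M: "finite_borel_measure M" and N: "finite_borel_measure N"
  shows "\<exists>P Q. jordan_decomposition (\<lambda>E. measure M E - measure N E) P Q"
proof -
  note M' = finite_borel_measureD[OF M] and N' = finite_borel_measureD[OF N]
  obtain Y where Y: "Y \<in> sets borel"
      "\<And>X. X \<in> sets borel \<Longrightarrow> X \<subseteq> Y \<Longrightarrow> emeasure N X \<le> emeasure M X"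
      "\<And>X. X \<in> sets borel \<Longrightarrow> X \<inter> Y = {} \<Longrightarrow> emeasure M X \<le> emeasure N X"
    using finite_unsigned_Hahn_decomposition[OF M'(2) N'(2)] M' N' by auto
  \<comment> \<open>Stated for general \<open>K\<close>, \<open>L\<close>, \<open>Z\<close> in order
    to be used twice, for \<open>M\<close>, \<open>N\<close> on \<open>Y\<close> and for
    \<open>N\<close>, \<open>M\<close> on the complement. Domination on subsets of \<open>Z\<close>
    is what turns the difference of the restrictions into a measure.\<close>
  have part: "\<exists>P. finite_borel_measure P \<and> (\<forall>E\<in>sets borel. measure P E = measure K (Z \<inter> E) - measure L (Z \<inter> E))"
    if K: "finite_borel_measure K" and L: "finite_borel_measure L" and Z: "Z \<in> sets borel"
      and le: "\<And>X. X \<in> sets borel \<Longrightarrow> X \<subseteq> Z \<Longrightarrow> emeasure L X \<le> emeasure K X"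
    for K L :: "'a measure" and Z
  proof -
    note K' = finite_borel_measureD[OF K] and L' = finite_borel_measureD[OF L]
    let ?K = "density K (indicator Z)" and ?L = "density L (indicator Z)"
    have eK: "emeasure ?K E = emeasure K (Z \<inter> E)" and eL: "emeasure ?L E = emeasure L (Z \<inter> E)"
      if "E \<in> sets borel" for E
      using that Z by (simp_all add: emeasure_restricted K'(1) L'(1))
    have fin: "finite_measure ?K" "finite_measure ?L"
      by (rule finite_measureI; simp add: eK eL K' L')+
    have diff: "emeasure (diff_measure ?K ?L) E = ennreal (measure K (Z \<inter> E) - measure L (Z \<inter> E))"
      if E: "E \<in> sets borel" for E
    proof -
      have "emeasure (diff_measure ?K ?L) E = emeasure ?K E - emeasure ?L E"
        by (rule emeasure_diff_measure[OF fin]) (use E Z le in \<open>auto simp: K' L' eK eL\<close>)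
      also have "\<dots> = ennreal (measure K (Z \<inter> E) - measure L (Z \<inter> E))"
        using E by (simp add: eK eL K'(4) L'(4) ennreal_minus)
      finally show ?thesis .
    qed
    have "finite_borel_measure (diff_measure ?K ?L)"
      unfolding finite_borel_measure_def by (auto intro!: finite_measureI simp: diff K')
    moreover have "measure (diff_measure ?K ?L) E = measure K (Z \<inter> E) - measure L (Z \<inter> E)"
      if E: "E \<in> sets borel" for E
      using le[of "Z \<inter> E"] E Z diff[OF E] by (simp add: measure_def[of "diff_measure ?K ?L"] K'(4) L'(4))
    ultimately show ?thesis by blast
  qed
  obtain P where P: "finite_borel_measure P"
      "\<And>E. E \<in> sets borel \<Longrightarrow> measure P E = measure M (Y \<inter> E) - measure N (Y \<inter> E)"
    using part[OF M N Y(1,2)] by blast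
  obtain Q where Q: "finite_borel_measure Q"
      "\<And>E. E \<in> sets borel \<Longrightarrow> measure Q E = measure N (- Y \<inter> E) - measure M (- Y \<inter> E)"
    using part[OF N M borel_comp[OF Y(1)]] Y(3) by (metis disjoint_eq_subset_Compl)
  have split: "measure K E = measure K (Y \<inter> E) + measure K (- Y \<inter> E)"
    if "finite_borel_measure K" "E \<in> sets borel" for K :: "'a measure" and E
  proof -
    have "Y \<inter> E \<union> - Y \<inter> E = E" "(Y \<inter> E) \<inter> (- Y \<inter> E) = {}" by auto
    then show ?thesis
      using finite_measure.finite_measure_Union[OF finite_borel_measureD(2)[OF that(1)],
          of "Y \<inter> E" "- Y \<inter> E"] that(2) Y(1)
      by (simp add: finite_borel_measureD(1)[OF that(1)])
  qed
  have "jordan_decomposition (\<lambda>E. measure M E - measure N E) P Q"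
    unfolding jordan_decomposition_def
  proof (intro conjI ballI bexI[of _ Y])
    show "measure M E - measure N E = measure P E - measure Q E" if "E \<in> sets borel" for E
      using split[OF M that] split[OF N that] P(2)[OF that] Q(2)[OF that] by simp
    show "emeasure P (- Y) = 0" "emeasure Q Y = 0"
      using P(2)[of "- Y"] Q(2)[of Y] Y(1)
      by (simp_all add: finite_borel_measureD(4)[OF P(1)] finite_borel_measureD(4)[OF Q(1)])
  qed (use P Q Y in auto)
  then show ?thesis by blast
qed

text \<open>If \<open>P\<close> and \<open>Q\<close> are the Jordan parts, the left side is the
  absolute difference of their masses and the right side is the sum of these masses.\<close>

lemma abs_le_total_mass:
  assumes "finite_borel_measure M" "finite_borel_measure N"
  shows "ennreal \<bar>measure M UNIV - measure N UNIV\<bar> \<le> total_mass (\<lambda>E. measure M E - measure N E)"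
proof -
  obtain P Q where J: "jordan_decomposition (\<lambda>E. measure M E - measure N E) P Q"
    using jordan_decomposition_exists[OF assms] by blast
  then have "finite_borel_measure P" "finite_borel_measure Q"
    and "measure M UNIV - measure N UNIV = measure P UNIV - measure Q UNIV"
    by (auto simp: jordan_decomposition_def)
  then show ?thesis
    by (simp add: total_mass_def jordan_eqI[OF J] finite_borel_measureD(4) ennreal_plus[symmetric]
        ennreal_leI abs_le_iff del: ennreal_plus)
qed

text \<open>Off the Hahn set of the Jordan parts the difference equals minus the negative part.
  Being nonnegative, it forces the negative part to vanish there as well.\<close>

lemma total_mass_diff_le:
  assumes M: "finite_borel_measure M" and N: "finite_borel_measure N"
    and le: "\<And>E. E \<in> sets borel \<Longrightarrow> measure N E \<le> measure M E"
  shows "total_mass (\<lambda>E. measure M E - measure N E) = ennreal (measure M UNIV - measure N UNIV)"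
proof -
  obtain P Q where J: "jordan_decomposition (\<lambda>E. measure M E - measure N E) P Q"
    using jordan_decomposition_exists[OF M N] by blast
  then obtain H where H: "H \<in> sets borel" "emeasure P (- H) = 0" "emeasure Q H = 0"
    by (auto simp: jordan_decomposition_def)
  have P: "finite_borel_measure P" and Q: "finite_borel_measure Q"
    and eq: "\<And>E. E \<in> sets borel \<Longrightarrow> measure M E - measure N E = measure P E - measure Q E"
    using J by (auto simp: jordan_decomposition_def)
  have "measure P (- H) = 0" using H by (simp add: measure_def)
  then have "measure Q (- H) = 0"
    using eq[of "- H"] le[of "- H"] borel_comp[OF H(1)] measure_nonneg[of Q "- H"] by linarith
  moreover have "measure Q H = 0" using H by (simp add: measure_def)
  moreover have "measure Q UNIV = measure Q H + measure Q (- H)"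
    using finite_measure.finite_measure_Union[OF finite_borel_measureD(2)[OF Q], of H "- H"] H(1)
    by (simp add: finite_borel_measureD(1)[OF Q])
  ultimately have "measure Q UNIV = 0" by simp
  then show ?thesis
    using eq[of UNIV]
    by (simp add: total_mass_def jordan_eqI[OF J] finite_borel_measureD(4)[OF P] finite_borel_measureD(4)[OF Q])
qed

section \<open>Bounds for the generalized Wasserstein distance\<close>

text \<open>If the competitors have common mass \<open>m\<close>, creating \<open>m\<close> from
  nothing and correcting \<open>K\<close> to mass \<open>m\<close> already costs
  \<open>m + |K - m|\<close>, which is at least the mass of \<open>K\<close>.\<close>

lemma gen_wasserstein_null_ge:
  assumes K: "finite_borel_measure K"
  shows "emeasure K UNIV \<le> gen_wasserstein d (null_measure borel) K"
  unfolding gen_wasserstein_def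
proof (rule INF_greatest, clarify)
  fix M N :: "'a measure"
  assume M: "finite_borel_measure M" and N: "finite_borel_measure N"
    and "emeasure M UNIV = emeasure N UNIV"
  then have mass: "measure M UNIV = measure N UNIV" by (simp add: measure_def)
  have "emeasure K UNIV \<le> ennreal (\<bar>0 - measure M UNIV\<bar> + \<bar>measure K UNIV - measure N UNIV\<bar>)"
    unfolding finite_borel_measureD(4)[OF K] by (rule ennreal_leI) (simp add: mass)
  also have "\<dots> = ennreal \<bar>0 - measure M UNIV\<bar> + ennreal \<bar>measure K UNIV - measure N UNIV\<bar>"
    by simp
  also have "\<dots> \<le> total_mass (\<lambda>E. measure (null_measure borel) E - measure M E) +
      total_mass (\<lambda>E. measure K E - measure N E)"
    using abs_le_total_mass[OF finite_borel_measure_null M] abs_le_total_mass[OF K N]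
    by (intro add_mono) (auto simp: measure_def)
  also have "\<dots> \<le> \<dots> + wasserstein1 d M N" by simp
  finally show "emeasure K UNIV \<le> \<dots>" .
qed

text \<open>Keep mass \<open>e\<close> of the atom at \<open>p\<close>, transport it into
  \<open>U\<close> at cost at most \<open>e\<close>, and delete the rest. The total is at most the
  full mass minus \<open>e\<close>.\<close>

lemma gen_wasserstein_atom_less:
  fixes M N :: "'a::t2_space measure" and p :: 'a
  assumes M: "finite_borel_measure M" and N: "finite_borel_measure N"
    and atom: "0 < a" "\<And>E. E \<in> sets borel \<Longrightarrow> a * indicator E p \<le> measure M E"
    and U: "open U" "0 < measure N U" "\<And>q. q \<in> U \<Longrightarrow> d p q \<le> 1"
  shows "gen_wasserstein d M N < emeasure M UNIV + emeasure N UNIV"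
proof -
  note N' = finite_borel_measureD[OF N] and M' = finite_borel_measureD[OF M]
  \<comment> \<open>\<open>e\<close> is bounded by \<open>a\<close> so that the kept atom stays
    below \<open>M\<close>, and by the mass of \<open>U\<close> so that \<open>s\<close> is at most
    1 and \<open>N1\<close> stays below \<open>N\<close>.\<close>
  define e where "e = min a (measure N U)"
  define s where "s = e / measure N U"
  have e: "0 < e" "e \<le> a" "e \<le> measure N U" and s: "0 \<le> s" "s \<le> 1" "s * measure N U = e"
    using atom(1) U(2) by (auto simp: e_def s_def)
  define M1 where "M1 = scale_measure (ennreal e) (return borel p)"
  define N1 where "N1 = scale_measure (ennreal s) (density N (indicator U))"
  have Ub: "U \<in> sets borel" using U(1) by simp
  have eM1: "emeasure M1 E = ennreal (e * indicator E p)" if "E \<in> sets borel" for E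
    using that e by (simp add: M1_def ennreal_mult ennreal_indicator)
  have eN1: "emeasure N1 E = ennreal (s * measure N (U \<inter> E))" if "E \<in> sets borel" for E
    using that Ub s by (simp add: N1_def emeasure_restricted N'(1) N'(4) ennreal_mult)
  have sets [measurable_cong, simp]: "sets M1 = sets borel" "sets N1 = sets borel"
    by (simp_all add: M1_def N1_def N')
  then have space [simp]: "space M1 = UNIV" "space N1 = UNIV"
    using sets_eq_imp_space_eq[of M1 borel] sets_eq_imp_space_eq[of N1 borel] by simp_all
  have fin: "finite_borel_measure M1" "finite_borel_measure N1"
    unfolding finite_borel_measure_def by (auto intro!: finite_measureI simp: eM1 eN1)
  have mM1: "measure M1 E = e * indicator E p" and mN1: "measure N1 E = s * measure N (U \<inter> E)"
    if "E \<in> sets borel" for E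
    using that e s by (simp_all add: measure_def[of M1] measure_def[of N1] eM1 eN1)
  have mass: "emeasure M1 UNIV = ennreal e" "emeasure N1 UNIV = ennreal e"
    using s by (simp_all add: eM1 eN1)

  \<comment> \<open>The coupling joins all of \<open>N1\<close> to the point \<open>p\<close>. It
    must live on the Borel sets of the product space, which may be more than the product
    sigma-algebra, so measurability is derived from continuity.\<close>
  have meas [measurable]: "Pair p \<in> borel_measurable N1"
    unfolding measurable_cong_sets[OF sets(2) refl]
    by (intro borel_measurable_continuous_onI continuous_intros)
  have [measurable]: "fst \<in> borel_measurable (borel :: ('a \<times> 'a) measure)"
    "snd \<in> borel_measurable (borel :: ('a \<times> 'a) measure)"
    by (intro borel_measurable_continuous_onI continuous_intros)+
  define \<pi> where "\<pi> = distr N1 borel (Pair p)"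
  have "finite_borel_measure \<pi>"
    unfolding finite_borel_measure_def \<pi>_def
    using finite_measure.finite_measure_distr[OF finite_borel_measureD(2)[OF fin(2)] meas] by simp
  moreover have "distr \<pi> borel fst = M1"
  proof (rule measure_eqI)
    fix E assume "E \<in> sets (distr \<pi> borel fst)"
    then have E: "E \<in> sets borel" by simp
    have "distr \<pi> borel fst = distr N1 borel (\<lambda>q. p)"
      by (simp add: \<pi>_def distr_distr o_def)
    then show "emeasure (distr \<pi> borel fst) E = emeasure M1 E"
      using E mass by (simp add: emeasure_distr eM1 split: split_indicator)
  qed simp
  moreover have "distr \<pi> borel snd = N1"
    by (simp add: \<pi>_def distr_distr o_def distr_id2)
  ultimately have "\<pi> \<in> couplings M1 N1"
    by (simp add: couplings_def)
  then have "wasserstein1 d M1 N1 \<le> (\<integral>\<^sup>+ (x, y). d x y \<partial>\<pi>)"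
    unfolding wasserstein1_def by (rule INF_lower)
  also have "\<dots> \<le> (\<integral>\<^sup>+ z. 1 \<partial>\<pi>)"
  proof (rule nn_integral_mono_AE, rule AE_I)
    \<comment> \<open>The bound \<open>d \<le> 1\<close> can fail only off
      \<open>{p} \<times> U\<close>. Writing this set as a closed set intersected with an open one
      shows that it is Borel; its complement is null because \<open>N1\<close> lives on
      \<open>U\<close>.\<close>
    let ?Z = "- ({p} \<times> UNIV \<inter> UNIV \<times> U)"
    show "{z \<in> space \<pi>. \<not> (case z of (x, y) \<Rightarrow> d x y) \<le> 1} \<subseteq> ?Z"
      using U(3) by auto
    have Z: "?Z \<in> sets borel"
      by (intro borel_comp sets.Int borel_open borel_closed open_Times closed_Times)
         (auto intro: U(1))
    then show "?Z \<in> sets \<pi>" by (simp add: \<pi>_def)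
    have "Pair p -` ?Z = - U" by auto
    then show "emeasure \<pi> ?Z = 0"
      using Ub Z by (simp add: \<pi>_def emeasure_distr eN1)
  qed
  also have "\<dots> = ennreal e"
    by (simp add: \<pi>_def emeasure_distr mass)
  finally have W: "wasserstein1 d M1 N1 \<le> ennreal e" .

  have tM: "total_mass (\<lambda>E. measure M E - measure M1 E) = ennreal (measure M UNIV - e)"
  proof (subst total_mass_diff_le[OF M fin(1)])
    show "measure M1 E \<le> measure M E" if "E \<in> sets borel" for E
      using atom(2)[OF that] e that by (auto simp: mM1 indicator_def split: if_splits)
  qed (simp add: mM1)
  have tN: "total_mass (\<lambda>E. measure N E - measure N1 E) = ennreal (measure N UNIV - e)"
  proof (subst total_mass_diff_le[OF N fin(2)])
    show "measure N1 E \<le> measure N E" if E: "E \<in> sets borel" for E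
    proof -
      have "s * measure N (U \<inter> E) \<le> measure N (U \<inter> E)"
        using s by (simp add: mult_left_le_one_le)
      also have "\<dots> \<le> measure N E"
        using N'(2) E N'(1) by (intro finite_measure.finite_measure_mono) auto
      finally show ?thesis by (simp add: mN1 E)
    qed
  qed (simp add: mN1 s)
  \<comment> \<open>These two inequalities ensure that \<open>ennreal\<close> does not truncate the
    differences, so that the three costs add up as real numbers.\<close>
  have "e \<le> measure M UNIV" using atom(2)[of UNIV] e by simp
  moreover have "e \<le> measure N UNIV"
    using e(3) finite_measure.finite_measure_mono[OF N'(2), of U UNIV] N'(1) by simp
  moreover have "gen_wasserstein d M N \<le>
      total_mass (\<lambda>E. measure M E - measure M1 E) + total_mass (\<lambda>E. measure N E - measure N1 E) +
      wasserstein1 d M1 N1"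
    unfolding gen_wasserstein_def
    by (rule INF_lower2[of "(M1, N1)"]) (use fin mass in auto)
  moreover have "\<dots> \<le> ennreal (measure M UNIV - e) + ennreal (measure N UNIV - e) + ennreal e"
    unfolding tM tN using W by (intro add_mono) auto
  ultimately have "gen_wasserstein d M N \<le> ennreal (measure M UNIV + measure N UNIV - e)"
    using e(1) by (simp add: ennreal_plus[symmetric] del: ennreal_plus)
  also have "\<dots> < ennreal (measure M UNIV + measure N UNIV)"
    using e(1) \<open>e \<le> measure M UNIV\<close> by (intro ennreal_lessI) (auto intro: add_pos_nonneg)
  finally show ?thesis by (simp add: M'(4) N'(4))
qed


section \<open>The rival strategy\<close>

text \<open>Push a scaled counting measure on the indices forward along \<open>x\<close>; coinciding
  points then count with multiplicity.\<close>

lemma weighted_point_measure_exists: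
  fixes x :: "'b \<Rightarrow> 'a::topological_space"
  assumes "finite J" "0 \<le> a"
  shows "\<exists>M. finite_borel_measure M \<and>
    (\<forall>E\<in>sets borel. measure M E = a * (\<Sum>j\<in>J. indicator E (x j)))"
proof -
  define M where "M = distr (scale_measure (ennreal a) (count_space J)) borel x"
  have "emeasure M E = ennreal (a * (\<Sum>j\<in>J. indicator E (x j)))" if E: "E \<in> sets borel" for E
  proof -
    have "emeasure M E = ennreal a * emeasure (count_space J) (x -` E \<inter> J)"
      unfolding M_def using E by (subst emeasure_distr) (auto simp: space_scale_measure measurable_def)
    also have "\<dots> = ennreal a * ennreal (card (x -` E \<inter> J))"
      using assms(1) by (simp add: emeasure_count_space ennreal_of_nat_eq_real_of_nat)
    also have "real (card (x -` E \<inter> J)) = (\<Sum>j\<in>J. indicator E (x j))"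
      using sum.inter_restrict[OF assms(1), of "\<lambda>_. 1 :: real" "x -` E"]
      by (simp add: indicator_def of_bool_def Int_commute)
    finally show ?thesis
      using assms(2) by (simp add: ennreal_mult sum_nonneg)
  qed
  moreover have "sets M = sets borel" by (simp add: M_def)
  ultimately have "finite_borel_measure M"
      "\<forall>E\<in>sets borel. measure M E = a * (\<Sum>j\<in>J. indicator E (x j))"
    using assms(2) sets_eq_imp_space_eq[of M borel]
    by (auto simp: finite_borel_measure_def measure_def sum_nonneg intro!: finite_measureI)
  then show ?thesis by blast
qed

text \<open>The first \<open>N\<close> Dirac masses cancel, leaving only the surplus shops of the
  rival.\<close>

lemma shop_measure_same:
  fixes x :: "nat \<Rightarrow> 'a::topological_space"
  assumes "N \<le> f N" "E \<in> sets borel"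
  shows "shop_measure f x x N E = - (\<Sum>j\<in>{N<..f N}. indicator E (x j))"
proof -
  have "{1..f N} = {1..N} \<union> {N<..f N}" using assms(1) by auto
  then have "(\<Sum>j=1..f N. indicator E (x j) :: real) =
      (\<Sum>j=1..N. indicator E (x j)) + (\<Sum>j\<in>{N<..f N}. indicator E (x j))"
    by (simp add: sum.union_disjoint disjoint_iff)
  then show ?thesis
    using assms(2) by (simp add: shop_measure_def measure_return)
qed

theorem theorem4p4:
  fixes A :: "('a::{t2_space, second_countable_topology}, 'd::finite) chart set"
    and g :: "('a, 'd) chart \<Rightarrow> 'a \<Rightarrow> real ^ 'd ^ 'd"
    and vol :: "'a measure"
    and f :: "nat \<Rightarrow> nat"
  assumes "CARD('d) \<ge> 3"
    and "compact (UNIV :: 'a set)"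
    and "smooth_atlas A"
    and "riemannian_metric A g"
    and "riemannian_volume A g vol"
    and "\<And>N. N \<ge> 1 \<Longrightarrow> f N \<ge> f (N - 1) + 2"
  shows "\<exists>N0. \<forall>x :: nat \<Rightarrow> 'a. \<exists>y :: nat \<Rightarrow> 'a. \<forall>N\<ge>N0.
    signed_wasserstein (riemannian_dist A g)
        (\<lambda>E. 1 / real (N + f N) * shop_measure f x y N E) (measure (normalized vol))
    > signed_wasserstein (riemannian_dist A g)
        (\<lambda>E. 1 / real (N + f N) * (- shop_measure f x y N E)) (measure (normalized vol))"
proof (intro exI[of _ 1] allI)
  fix x :: "nat \<Rightarrow> 'a"
  let ?d = "riemannian_dist A g" and ?V = "normalized vol"
  have sets_vol: "sets vol = sets borel"
    using assms(5) by (simp add: riemannian_volume_def)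
  then have space_vol: "space vol = UNIV"
    using sets_eq_imp_space_eq by force
  have vol_fin: "emeasure vol UNIV < \<infinity>"
    by (rule riemannian_volume_finite[OF assms(2-5)])
  have V: "emeasure ?V E = inverse (emeasure vol UNIV) * emeasure vol E" for E
    by (simp add: normalized_def space_vol)
  have V_pos: "0 < emeasure ?V U" if "0 < emeasure vol U" for U
    using that vol_fin by (simp add: V ennreal_zero_less_mult_iff ennreal_inverse_positive)
  \<comment> \<open>Normalization divides by the total volume, and the inverse of 0 would be
    infinite. The point \<open>x 0\<close> is merely some point of the manifold.\<close>
  have "emeasure vol UNIV \<noteq> 0"
    by (rule chart_neighbourhood[OF assms(3-5), of "x 0"])
       (use sets_vol in \<open>metis emeasure_mono subset_UNIV sets.top space_vol not_less zero_less_iff_neq_zero\<close>)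
  then have "emeasure ?V UNIV < \<infinity>"
    using vol_fin by (auto simp: V ennreal_mult_eq_top_iff less_top[symmetric])
  then have fin_V: "finite_borel_measure ?V"
    by (auto simp: finite_borel_measure_def normalized_def sets_vol space_scale_measure space_vol
        intro!: finite_measureI)
  note JV = jordan_eqI[OF jordan_decomposition_measure[OF fin_V refl]]
  \<comment> \<open>For \<open>N \<ge> 1\<close> this leaves at least one surplus shop, so 1 is a
    valid threshold. At 0 it could fail, since \<open>f 0\<close> may be 0.\<close>
  have f_ge: "2 * N \<le> f N" for N
  proof (induction N)
    case (Suc N)
    then show ?case using assms(6)[of "Suc N"] by simp
  qed simp

  have "signed_wasserstein ?d (\<lambda>E. 1 / real (N + f N) * (- shop_measure f x x N E)) (measure ?V)
      < signed_wasserstein ?d (\<lambda>E. 1 / real (N + f N) * shop_measure f x x N E) (measure ?V)"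
    if "N \<ge> 1" for N
  proof -
    let ?a = "1 / real (N + f N)"
    \<comment> \<open>\<open>Suc N\<close> is the index of the first surplus shop; its location is
      the atom, of weight at least \<open>?a\<close>, that is partly transported.\<close>
    have a: "?a > 0" and N: "Suc N \<in> {N<..f N}" "N \<le> f N"
      using that f_ge[of N] by auto
    obtain M where M: "finite_borel_measure M"
        "\<And>E. E \<in> sets borel \<Longrightarrow> measure M E = ?a * (\<Sum>j\<in>{N<..f N}. indicator E (x j))"
      using weighted_point_measure_exists[of "{N<..f N}" ?a x] a by auto
    have J: "jordan_decomposition (\<lambda>E. ?a * (- shop_measure f x x N E)) M (null_measure borel)"
      by (rule jordan_decomposition_measure[OF M(1)]) (simp add: M(2) shop_measure_same[of N f, OF N(2)])
    have "jordan_decomposition (\<lambda>E. ?a * shop_measure f x x N E) (null_measure borel) M"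
      using jordan_decomposition_uminus[OF J] by simp
    note J_neg = jordan_eqI[OF J] and J_pos = jordan_eqI[OF this]
    have setsM: "sets M = sets borel" "sets ?V = sets borel"
      using M(1) fin_V by (auto simp: finite_borel_measure_def)
    obtain U where U: "open U" "0 < emeasure vol U" "\<And>q. q \<in> U \<Longrightarrow> ?d (x (Suc N)) q \<le> 1"
      using chart_neighbourhood[OF assms(3-5), of "x (Suc N)"] by metis
    \<comment> \<open>Here \<open>M\<close> is a positive part and faces the volume, so transport
      between them is possible.\<close>
    have "signed_wasserstein ?d (\<lambda>E. ?a * (- shop_measure f x x N E)) (measure ?V) =
        gen_wasserstein ?d M ?V"
      unfolding signed_wasserstein_def J_neg JV by (simp add: add_measure_null setsM)
    also have "\<dots> < emeasure M UNIV + emeasure ?V UNIV"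
    proof (rule gen_wasserstein_atom_less[OF M(1) fin_V a])
      show "?a * indicator E (x (Suc N)) \<le> measure M E" if "E \<in> sets borel" for E
        unfolding M(2)[OF that] using a N(1)
        by (intro mult_left_mono member_le_sum[of "Suc N"]) auto
      show "0 < measure ?V U"
        using V_pos[OF U(2)] finite_borel_measureD(4)[OF fin_V, of U] by simp
    qed (use U in auto)
    also have "\<dots> = emeasure (add_measure M ?V) UNIV"
      by (simp add: emeasure_add_measure setsM)
    also have "\<dots> \<le> gen_wasserstein ?d (null_measure borel) (add_measure M ?V)"
      by (rule gen_wasserstein_null_ge[OF finite_borel_measure_add[OF M(1) fin_V]])
    \<comment> \<open>With the opposite sign \<open>M\<close> is a negative part and lands on the
      same side as the volume, facing the null measure.\<close>
    also have "\<dots> = signed_wasserstein ?d (\<lambda>E. ?a * shop_measure f x x N E) (measure ?V)"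
      unfolding signed_wasserstein_def J_pos JV by (simp add: add_measure_null)
    finally show ?thesis .
  qed
  then show "\<exists>y. \<forall>N\<ge>1. signed_wasserstein ?d (\<lambda>E. 1 / real (N + f N) * (- shop_measure f x y N E)) (measure ?V)
      < signed_wasserstein ?d (\<lambda>E. 1 / real (N + f N) * shop_measure f x y N E) (measure ?V)"
    by blast
qed

end
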